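(* Let $m\ge 1$ and $n\ge 2$ be integers, let $q=\binom m2$, and let $D=\{x_1,\ldots,x_n\}$ be an $n$-run order-of-addition (OofA) design with $m$ components. Let $C_1(D)$ and $C_2(D)$ be the first two entries of the centralized generalized wordlength pattern of $D$. Then $$C_1(D)=q-\frac{2(n-1)}{n}\,k_{\mathrm{ave}}(D),$$ and $$C_2(D)=\frac{q(q-1)}{2}-\frac{2q(n-1)}{n}\,k_{\mathrm{ave}}(D)+\frac{2(n-1)}{n}\,k_{m_2}(D)-\frac{m(m-1)(m-2)}{18}.$$
   Context: Let $\mathcal{Z}_m=\{0,1,\ldots,m-1\}$ and let $\mathcal{S}_m$ be the set of all permutations (orderings) of $\mathcal{Z}_m$. An $n$-run OofA design with $m$ components is a list (repetitions allowed) $D=\{x_1,\ldots,x_n\}$ of $n$ elements of $\mathcal{S}_m$, called runs. The full design $D_{\mathrm{full}}$ consists of all $m!$ elements of $\mathcal{S}_m$, each once. For $x\in\mathcal{S}_m$ and $c\in\mathcal{Z}_m$, $\pi_x(c)$ denotes the position of $c$ in $x$. Kendall tau distance: $k(x,y)=\#\{(a,b):0\le a<b\le m-1,\ (\pi_x(a)-\pi_x(b))(\pi_y(a)-\pi_y(b))<0\}$. Distance criteria: $k_{\mathrm{ave}}(D)=\binom{n}{2}^{-1}\sum_{1\le i<j\le n}k(x_i,x_j)$ and $k_{m_2}(D)=\binom{n}{2}^{-1}\sum_{1\le i<j\le n}k(x_i,x_j)^2$. Pairwise ordering coding: for $0\le a<b\le m-1$, $z_{ab}(x)=+1$ if $\pi_x(a)<\pi_x(b)$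 and $z_{ab}(x)=-1$ otherwise. Let $\mathcal{Q}=\{(a,b):0\le a<b\le m-1\}$, so $|\mathcal{Q}|=q$. For $W\subseteq\mathcal{Q}$ put $z_W(x)=\prod_{(a,b)\in W}z_{ab}(x)$ (with $z_\emptyset=1$), and $J_W(D)=\sum_{x\in D}z_W(x)$ (sum over the runs, counted with multiplicity). Centralized generalized wordlength pattern: for an $n$-run design $D$, $$C_a(D)=\sum_{W\subseteq\mathcal{Q},\ |W|=a}\left\{\frac{J_W(D)}{n}-\frac{J_W(D_{\mathrm{full}})}{m!}\right\}^2,$$ with an empty sum (when $a>q$) equal to $0$. *)

theory Defs
  imports Complex_Main "HOL-Combinatorics.Multiset_Permutations"
begin

definition runs :: "nat \<Rightarrow> nat list set" where
  "runs m = permutations_of_set {0..<m}"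

(* A design is a list of runs, so repeated runs are allowed. *)
definition oofa_design :: "nat \<Rightarrow> nat \<Rightarrow> nat list list \<Rightarrow> bool" where
  "oofa_design m n D \<longleftrightarrow> length D = n \<and> set D \<subseteq> runs m"

(* A full design has no preferred order of its runs, hence a multiset. *)
definition full_design :: "nat \<Rightarrow> nat list multiset" where
  "full_design m = mset_set (runs m)"

(* Positions are counted from 0; only their relative order is ever used.
   The value is meaningful when c occurs exactly once in x. *)
definition pos :: "nat list \<Rightarrow> nat \<Rightarrow> nat" where
  "pos x c = (THE i. i < length x \<and> x ! i = c)"

lemma pos_nth: "distinct x \<Longrightarrow> i < length x \<Longrightarrow> pos x (x ! i) = i"
  unfolding pos_def by (rule the_equality) (auto simp: nth_eq_iff_index_eq)

definition comp_pairs :: "nat \<Rightarrow> (nat \<times> nat) set" where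
  "comp_pairs m = {(a, b). a < b \<and> b < m}"

definition kendall_tau :: "nat \<Rightarrow> nat list \<Rightarrow> nat list \<Rightarrow> nat" where
  "kendall_tau m x y = card {(a, b). (a, b) \<in> comp_pairs m \<and>
     (int (pos x a) - int (pos x b)) * (int (pos y a) - int (pos y b)) < 0}"

definition k_ave :: "nat \<Rightarrow> nat list list \<Rightarrow> real" where
  "k_ave m D = (\<Sum>(i, j) \<in> {(i, j). i < j \<and> j < length D}.
     real (kendall_tau m (D ! i) (D ! j))) / real (length D choose 2)"

definition k_m2 :: "nat \<Rightarrow> nat list list \<Rightarrow> real" where
  "k_m2 m D = (\<Sum>(i, j) \<in> {(i, j). i < j \<and> j < length D}.
     (real (kendall_tau m (D ! i) (D ! j)))\<^sup>2) / real (length D choose 2)"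

definition pwo :: "nat \<times> nat \<Rightarrow> nat list \<Rightarrow> real" where
  "pwo p x = (if pos x (fst p) < pos x (snd p) then 1 else - 1)"

definition pwo_prod :: "(nat \<times> nat) set \<Rightarrow> nat list \<Rightarrow> real" where
  "pwo_prod W x = (\<Prod>p\<in>W. pwo p x)"

definition J_char :: "(nat \<times> nat) set \<Rightarrow> nat list multiset \<Rightarrow> real" where
  "J_char W D = (\<Sum>x\<in>#D. pwo_prod W x)"

definition cgwlp :: "nat \<Rightarrow> nat \<Rightarrow> nat list list \<Rightarrow> real" where
  "cgwlp m a D = (\<Sum>W \<in> {W. W \<subseteq> comp_pairs m \<and> card W = a}.
     (J_char W (mset D) / real (length D) - J_char W (full_design m) / fact m)\<^sup>2)"

end

theory Submission
  imports Defs
begin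

text \<open>
  Ordered pairs of pairwise codings represent the two-element sets \<open>W\<close> twice, and the diagonal
  contributes nothing to the pattern since \<open>z\<^sup>2 = 1\<close> makes both means equal. Expanding the square
  \<open>(J\<^sub>W(D)/n - J\<^sub>W(full)/m!)\<^sup>2\<close> and summing over \<open>W\<close>, the first term is an average over pairs of
  runs of \<open>\<Sum>\<^sub>p z\<^sub>p(x) z\<^sub>p(y) = q - 2 k(x, y)\<close> or of its square. The other two terms combine to a
  constant, because \<open>\<Sum>\<^sub>W z\<^sub>W(x) J\<^sub>W(full)/m!\<close> does not depend on the run \<open>x\<close>: the mean of
  \<open>z\<^sub>a\<^sub>b z\<^sub>c\<^sub>d\<close> over all runs is \<open>0\<close> for disjoint pairs and \<open>1/3\<close> up to sign for pairs sharing one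
  component, which reduces the sum to \<open>\<Sum>\<^sub>a (m - 1 - 2 \<pi>\<^sub>x(a))\<^sup>2\<close>.
\<close>

section \<open>Sums over pairs of indices and over two-element subsets\<close>

lemma finite_comp_pairs [simp]: "finite (comp_pairs m)"
  by (rule finite_subset[of _ "{..<m} \<times> {..<m}"]) (auto simp: comp_pairs_def)

text \<open>Induction on \<open>m\<close>: the new index adds a last row and a last column, equal by
  symmetry, and a zero diagonal entry. It serves pairs of components as well as pairs of run
  indices.\<close>

lemma sum_comp_pairs:
  fixes f :: "nat \<Rightarrow> nat \<Rightarrow> real"
  assumes "\<And>a b. a < m \<Longrightarrow> b < m \<Longrightarrow> f a b = f b a" and "\<And>a. a < m \<Longrightarrow> f a a = 0"
  shows "(\<Sum>a<m. \<Sum>b<m. f a b) = 2 * (\<Sum>(a, b)\<in>comp_pairs m. f a b)"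
  using assms
proof (induction m)
  case 0
  then show ?case by (simp add: comp_pairs_def)
next
  case (Suc m)
  have "comp_pairs (Suc m) = comp_pairs m \<union> (\<lambda>a. (a, m)) ` {..<m}"
    by (auto simp: comp_pairs_def)
  moreover have "comp_pairs m \<inter> (\<lambda>a. (a, m)) ` {..<m} = {}"
    by (auto simp: comp_pairs_def)
  ultimately have "(\<Sum>(a, b)\<in>comp_pairs (Suc m). f a b)
      = (\<Sum>(a, b)\<in>comp_pairs m. f a b) + (\<Sum>(a, b)\<in>(\<lambda>a. (a, m)) ` {..<m}. f a b)"
    by (simp add: sum.union_disjoint)
  also have "(\<Sum>(a, b)\<in>(\<lambda>a. (a, m)) ` {..<m}. f a b) = (\<Sum>a<m. f a m)"
    by (subst sum.reindex) (auto simp: inj_on_def)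
  finally have *: "(\<Sum>(a, b)\<in>comp_pairs (Suc m). f a b)
      = (\<Sum>(a, b)\<in>comp_pairs m. f a b) + (\<Sum>a<m. f a m)" .
  have "(\<Sum>b<m. f m b) = (\<Sum>a<m. f a m)"
    by (rule sum.cong) (auto intro!: Suc.prems(1))
  then show ?case
    using Suc.IH Suc.prems by (simp add: * sum.distrib)
qed

lemma card_comp_pairs: "real (card (comp_pairs m)) = real m * (real m - 1) / 2"
proof -
  have "(\<Sum>b<m. if a = b then 0 else 1) = real m - 1" if "a < m" for a
  proof -
    have "(\<Sum>b<m. if a = b then 0 else 1) = (\<Sum>b<m. 1 - (if a = b then 1 else 0 :: real))"
      by (rule sum.cong) auto
    then show ?thesis using that by (simp add: sum_subtractf)
  qed
  then have "real m * (real m - 1) = (\<Sum>a<m. \<Sum>b<m. if a = b then 0 else 1)"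
    by simp
  also have "\<dots> = 2 * (\<Sum>(a, b)\<in>comp_pairs m. if a = b then 0 else 1)"
    by (rule sum_comp_pairs) auto
  also have "(\<Sum>(a, b)\<in>comp_pairs m. if a = b then 0 else 1) = (\<Sum>p\<in>comp_pairs m. 1 :: real)"
    by (rule sum.cong) (auto simp: comp_pairs_def)
  finally show ?thesis by simp
qed

lemma choose_two_real: "real (n choose 2) = real n * (real n - 1) / 2"
  by (cases n) (auto simp: choose_two real_of_nat_div field_simps)

text \<open>Each two-element set arises from its two orderings. In the induction the new sets are
  \<open>{p, r}\<close> with \<open>r\<close> in \<open>Q\<close>, reached once with
  \<open>p\<close> first and once with \<open>p\<close> second.\<close>

lemma sum_two_element_subsets:
  fixes g :: "'a set \<Rightarrow> real"
  assumes "finite Q"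
  shows "(\<Sum>p\<in>Q. \<Sum>r\<in>Q. if p = r then 0 else g {p, r}) = 2 * (\<Sum>W | W \<subseteq> Q \<and> card W = 2. g W)"
  using assms
proof (induction Q)
  case empty
  have "{W :: 'a set. W \<subseteq> {} \<and> card W = 2} = {}" by auto
  then show ?case by (simp only: sum.empty mult_zero_right)
next
  case (insert p Q)
  have "{W. W \<subseteq> insert p Q \<and> card W = 2} = {W. W \<subseteq> Q \<and> card W = 2} \<union> (\<lambda>r. {p, r}) ` Q"
    (is "?L = ?R")
  proof
    show "?R \<subseteq> ?L" using insert.hyps by (auto simp: card_insert_if)
    show "?L \<subseteq> ?R"
    proof
      fix W assume "W \<in> ?L"
      then have W: "W \<subseteq> insert p Q" "card W = 2" by auto
      then obtain u v where "W = {u, v}" "u \<noteq> v" by (auto simp: card_2_iff)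
      with W show "W \<in> ?R" by (cases "u = p"; cases "v = p") auto
    qed
  qed
  moreover have "{W. W \<subseteq> Q \<and> card W = 2} \<inter> (\<lambda>r. {p, r}) ` Q = {}"
    using insert.hyps by auto
  ultimately have "(\<Sum>W | W \<subseteq> insert p Q \<and> card W = 2. g W)
      = (\<Sum>W | W \<subseteq> Q \<and> card W = 2. g W) + (\<Sum>W\<in>(\<lambda>r. {p, r}) ` Q. g W)"
    using insert.hyps by (simp add: sum.union_disjoint)
  also have "(\<Sum>W\<in>(\<lambda>r. {p, r}) ` Q. g W) = (\<Sum>r\<in>Q. g {p, r})"
    using insert.hyps by (subst sum.reindex) (auto simp: inj_on_def doubleton_eq_iff)
  finally have *: "(\<Sum>W | W \<subseteq> insert p Q \<and> card W = 2. g W)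
      = (\<Sum>W | W \<subseteq> Q \<and> card W = 2. g W) + (\<Sum>r\<in>Q. g {p, r})" .
  have "(\<Sum>r\<in>Q. if p = r then 0 else g {p, r}) = (\<Sum>r\<in>Q. g {p, r})"
    "(\<Sum>r\<in>Q. if r = p then 0 else g {r, p}) = (\<Sum>r\<in>Q. g {p, r})"
    using insert.hyps by (auto intro!: sum.cong simp: insert_commute)
  then show ?case
    using insert.IH insert.hyps by (simp add: * sum.distrib)
qed

text \<open>When the inner product of a vector of the population with the population mean is constant,
  centering only subtracts that constant.\<close>
lemma sum_centered_squares:
  fixes v :: "'a \<Rightarrow> 'k \<Rightarrow> real"
  assumes "finite R" "R \<noteq> {}" "n > 0"
    and D: "\<And>i. i < n \<Longrightarrow> D i \<in> R"
    and T: "\<And>x. x \<in> R \<Longrightarrow> (\<Sum>k\<in>K. v x k * ((\<Sum>y\<in>R. v y k) / real (card R))) = T"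
  shows "(\<Sum>k\<in>K. ((\<Sum>i<n. v (D i) k) / real n - (\<Sum>y\<in>R. v y k) / real (card R))\<^sup>2)
    = (\<Sum>i<n. \<Sum>j<n. \<Sum>k\<in>K. v (D i) k * v (D j) k) / (real n)\<^sup>2 - T"
proof -
  define F where "F = (\<lambda>k. (\<Sum>y\<in>R. v y k) / real (card R))"
  define G where "G = (\<lambda>k. (\<Sum>i<n. v (D i) k) / real n)"
  have "(\<Sum>k\<in>K. G k * F k) = (\<Sum>k\<in>K. \<Sum>i<n. v (D i) k * F k) / real n"
    by (simp add: G_def sum_divide_distrib sum_distrib_right)
  also have "(\<Sum>k\<in>K. \<Sum>i<n. v (D i) k * F k) = (\<Sum>i<n. \<Sum>k\<in>K. v (D i) k * F k)"
    by (rule sum.swap)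
  also have "\<dots> = (\<Sum>i<n. T)"
    by (intro sum.cong refl) (use T D in \<open>simp add: F_def\<close>)
  finally have GF: "(\<Sum>k\<in>K. G k * F k) = T" using \<open>n > 0\<close> by simp
  \<comment> \<open>\<open>F\<close> is itself an average of population vectors, so averaging the
    hypothesis on \<open>T\<close> over \<open>R\<close> gives its squared norm.\<close>
  have "(\<Sum>k\<in>K. F k * F k) = (\<Sum>k\<in>K. \<Sum>y\<in>R. v y k * F k) / real (card R)"
    by (subst (2) F_def) (simp add: F_def sum_divide_distrib sum_distrib_right)
  also have "(\<Sum>k\<in>K. \<Sum>y\<in>R. v y k * F k) = (\<Sum>y\<in>R. \<Sum>k\<in>K. v y k * F k)"
    by (rule sum.swap)
  also have "\<dots> = (\<Sum>y\<in>R. T)"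
    by (intro sum.cong refl) (use T in \<open>simp add: F_def\<close>)
  finally have FF: "(\<Sum>k\<in>K. F k * F k) = T" using assms(1,2) by simp
  have "(\<Sum>k\<in>K. G k * G k)
      = (\<Sum>k\<in>K. \<Sum>i<n. \<Sum>j<n. v (D i) k * v (D j) k) / (real n)\<^sup>2"
    by (simp add: G_def sum_product sum_divide_distrib power2_eq_square)
  also have "(\<Sum>k\<in>K. \<Sum>i<n. \<Sum>j<n. v (D i) k * v (D j) k)
      = (\<Sum>i<n. \<Sum>j<n. \<Sum>k\<in>K. v (D i) k * v (D j) k)"
    by (subst sum.swap, rule sum.cong[OF refl], rule sum.swap)
  finally have GG: "(\<Sum>k\<in>K. G k * G k)
      = (\<Sum>i<n. \<Sum>j<n. \<Sum>k\<in>K. v (D i) k * v (D j) k) / (real n)\<^sup>2" .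
  have "(\<Sum>k\<in>K. (G k - F k)\<^sup>2)
      = (\<Sum>k\<in>K. G k * G k) - 2 * (\<Sum>k\<in>K. G k * F k) + (\<Sum>k\<in>K. F k * F k)"
    by (simp add: power2_eq_square algebra_simps sum.distrib sum_subtractf sum_distrib_left)
  with GF FF GG show ?thesis by (simp add: F_def G_def)
qed

section \<open>Runs as permutations and the signs of their pairs\<close>

lemma runsD:
  assumes "x \<in> runs m"
  shows "distinct x" "set x = {..<m}" "length x = m"
proof -
  show x: "distinct x" "set x = {..<m}"
    using permutations_of_setD[OF assms[unfolded runs_def]] by (simp_all only: atLeast0LessThan)
  show "length x = m" using distinct_card[OF x(1)] x(2) by simp
qed

lemma finite_runs [simp]: "finite (runs m)"
  by (simp add: runs_def)

lemma card_runs: "card (runs m) = fact m"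
  by (simp add: runs_def)

lemma bij_betw_pos:
  assumes "x \<in> runs m"
  shows "bij_betw (pos x) {..<m} {..<m}"
proof (rule bij_betw_byWitness[where f' = "\<lambda>i. x ! i"])
  note x = runsD[OF assms]
  have *: "\<exists>i<m. x ! i = c" if "c < m" for c
    using that x by (metis in_set_conv_nth lessThan_iff)
  show "\<forall>c\<in>{..<m}. x ! pos x c = c" "pos x ` {..<m} \<subseteq> {..<m}"
    using * pos_nth[OF x(1)] x(3) by fastforce+
  show "\<forall>i\<in>{..<m}. pos x (x ! i) = i"
    using pos_nth[OF x(1)] x(3) by simp
  show "(!) x ` {..<m} \<subseteq> {..<m}"
    using x nth_mem by fastforce
qed

lemma pos_eq_iff:
  assumes "x \<in> runs m" "a < m" "b < m"
  shows "pos x a = pos x b \<longleftrightarrow> a = b"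
  using bij_betw_pos[OF assms(1)] assms(2,3) by (auto simp: bij_betw_def inj_on_def)

text \<open>Injectivity makes the predicates under the two \<open>THE\<close> operators equal, so
  the identity covers default values too.\<close>

lemma pos_map: "inj f \<Longrightarrow> pos (map f x) (f c) = pos x c"
  unfolding pos_def by (rule arg_cong[where f = The]) (auto simp: inj_eq)

text \<open>An antisymmetric extension of the coding \<^const>\<open>pwo\<close> to all pairs of components,
  so that relabelling components never leaves its domain.\<close>
definition ord_sign :: "nat list \<Rightarrow> nat \<Rightarrow> nat \<Rightarrow> real" where
  "ord_sign x a b = sgn (real (pos x b) - real (pos x a))"

lemma ord_sign_same [simp]: "ord_sign x a a = 0"
  by (simp add: ord_sign_def)

lemma ord_sign_swap: "ord_sign x b a = - ord_sign x a b"
  by (simp add: ord_sign_def sgn_if)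

lemma ord_sign_map: "inj f \<Longrightarrow> ord_sign (map f x) (f a) (f b) = ord_sign x a b"
  by (simp add: ord_sign_def pos_map)

lemma ord_sign_sq:
  assumes "x \<in> runs m" "a < m" "b < m"
  shows "ord_sign x a b * ord_sign x a b = (if a = b then 0 else 1)"
  using pos_eq_iff[OF assms] by (auto simp: ord_sign_def sgn_if)

lemma pwo_eq_ord_sign:
  assumes "x \<in> runs m" "(a, b) \<in> comp_pairs m"
  shows "pwo (a, b) x = ord_sign x a b"
proof -
  have "a < m" "b < m" "a \<noteq> b" using assms(2) by (auto simp: comp_pairs_def)
  then show ?thesis
    using pos_eq_iff[OF assms(1), of a b] by (simp add: pwo_def ord_sign_def sgn_if)
qed

lemma pwo_sq [simp]: "pwo p x * pwo p x = 1"
  by (simp add: pwo_def)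

section \<open>First and second moments of the signs over all runs\<close>

lemma sum_runs_relabel:
  assumes "a < m" "b < m"
  shows "(\<Sum>x\<in>runs m. h (map (transpose a b) x)) = (\<Sum>x\<in>runs m. h x)"
proof (rule sum.reindex_bij_witness[where i = "map (transpose a b)" and j = "map (transpose a b)"])
  fix x assume "x \<in> runs m"
  moreover have "transpose a b ` {0..<m} = {0..<m}"
    using assms by simp
  ultimately have "distinct x" "transpose a b ` set x = {0..<m}"
    by (simp_all add: runs_def permutations_of_set_def)
  then show "map (transpose a b) x \<in> runs m"
    by (simp add: runs_def permutations_of_set_def distinct_map)
  \<comment> \<open>The transposition is an involution, so one map serves as both witnesses and the
    same membership goal arises twice.\<close>
  then show "map (transpose a b) x \<in> runs m" .
qed (simp_all add: comp_def)

text \<open>Exchanging two labels merely permutes the runs. The symmetries of the second moments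
  below are instances of this.\<close>

lemma sum_ord_sign_relabel:
  assumes "u < m" "v < m"
  shows "(\<Sum>x\<in>runs m. ord_sign x (transpose u v a) (transpose u v b)
          * ord_sign x (transpose u v c) (transpose u v d))
       = (\<Sum>x\<in>runs m. ord_sign x a b * ord_sign x c d)"
  by (subst sum_runs_relabel[OF assms, symmetric]) (simp add: ord_sign_map)

text \<open>Exchanging \<open>a\<close> and \<open>b\<close> permutes the runs and negates the sign,
  so the sum is its own negative.\<close>

lemma sum_ord_sign:
  assumes "a < m" "b < m"
  shows "(\<Sum>x\<in>runs m. ord_sign x a b) = 0"
proof -
  have "ord_sign (map (transpose a b) x) a b = ord_sign x b a" for x
    using ord_sign_map[of "transpose a b" x b a] by simp
  then have "(\<Sum>x\<in>runs m. ord_sign x b a) = (\<Sum>x\<in>runs m. ord_sign x a b)"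
    using sum_runs_relabel[OF assms, of "\<lambda>x. ord_sign x a b"] by simp
  then show ?thesis by (simp add: ord_sign_swap[of _ b a] sum_negf)
qed

text \<open>Exchanging \<open>a\<close> and \<open>b\<close> negates the first factor and fixes the
  second.\<close>

lemma sum_ord_sign_disjoint:
  assumes "a < m" "b < m" "c \<notin> {a, b}" "d \<notin> {a, b}"
  shows "(\<Sum>x\<in>runs m. ord_sign x a b * ord_sign x c d) = 0"
  using sum_ord_sign_relabel[OF assms(1,2), of a b c d] assms(3,4)
  by (simp add: ord_sign_swap[of _ b a] sum_negf)

text \<open>In every run exactly one of three components is in the middle. Its two signs have product \<open>-1\<close>,
  the products at the two outer components are \<open>1\<close>, and by symmetry all three have equal means.\<close>
lemma sum_ord_sign_adjacent:
  assumes "a < m" "b < m" "c < m" "a \<noteq> b" "a \<noteq> c" "b \<noteq> c"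
  shows "(\<Sum>x\<in>runs m. ord_sign x a b * ord_sign x a c) = fact m / 3"
proof -
  let ?S = "\<lambda>a b c. \<Sum>x\<in>runs m. ord_sign x a b * ord_sign x a c"
  have "ord_sign x a b * ord_sign x a c + ord_sign x b a * ord_sign x b c
      + ord_sign x c b * ord_sign x c a = 1" if "x \<in> runs m" for x
    using pos_eq_iff[OF that, of a b] pos_eq_iff[OF that, of a c] pos_eq_iff[OF that, of b c] assms
    by (simp add: ord_sign_def sgn_if)
  then have "(\<Sum>x\<in>runs m. ord_sign x a b * ord_sign x a c + ord_sign x b a * ord_sign x b c
      + ord_sign x c b * ord_sign x c a) = fact m"
    by (simp add: card_runs)
  then have "?S a b c + ?S b a c + ?S c b a = fact m"
    by (simp add: sum.distrib)
  moreover have "?S b a c = ?S a b c"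
    using sum_ord_sign_relabel[of a m b a b a c] assms by simp
  moreover have "?S c b a = ?S a b c"
    using sum_ord_sign_relabel[of a m c a b a c] assms by simp
  ultimately show ?thesis by simp
qed

text \<open>The indicator form lets later sums over \<open>c\<close> and \<open>d\<close> collapse.
  Exactly one shared component gives 1/3 up to sign; if both are shared, the last two terms raise
  2/3 to 1 in absolute value; for \<open>a = b\<close> or \<open>c = d\<close> everything
  cancels.\<close>

lemma mean_ord_sign_product:
  assumes "a < m" "b < m" "c < m" "d < m"
  shows "(\<Sum>x\<in>runs m. ord_sign x a b * ord_sign x c d) / fact m
    = (of_bool (a = c) + of_bool (b = d) - of_bool (a = d) - of_bool (b = c)
       + of_bool (a = c \<and> b = d) - of_bool (a = d \<and> b = c)) / 3"
    (is "?S a b c d / _ = _")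
proof -
  have sq: "?S u v u v = fact m" if "u \<noteq> v" "u < m" "v < m" for u v
    using that by (simp add: ord_sign_sq card_runs)
  have swap1: "?S u v w z = - ?S v u w z" for u v w z
    by (simp add: ord_sign_swap[of _ u v] sum_negf)
  have swap2: "?S u v w z = - ?S u v z w" for u v w z
    by (simp add: ord_sign_swap[of _ w z] sum_negf)
  note adj = sum_ord_sign_adjacent
  \<comment> \<open>The cases are: a degenerate pair, equal pairs up to order, exactly one shared
    component in its four placements, and disjoint pairs.\<close>
  consider "a = b" | "c = d" | "a \<noteq> b" "a = c" "b = d" | "a \<noteq> b" "a = d" "b = c"
    | "a \<noteq> b" "c \<noteq> d" "a = c" "b \<noteq> d" | "a \<noteq> b" "c \<noteq> d" "b = d" "a \<noteq> c"
    | "a \<noteq> b" "c \<noteq> d" "a = d" "b \<noteq> c" | "a \<noteq> b" "c \<noteq> d" "b = c" "a \<noteq> d"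
    | "a \<noteq> b" "c \<notin> {a, b}" "d \<notin> {a, b}" by blast
  then show ?thesis
  proof cases
    case 3
    then show ?thesis using sq[of a b] assms by simp
  next
    case 4
    then show ?thesis using sq[of a b] swap2[of a b b a] assms by simp
  next
    case 5
    then show ?thesis using adj[of a m b d] assms by simp
  next
    case 6
    then show ?thesis using adj[of b m a c] swap1[of a b c b] swap2[of b a c b] assms by simp
  next
    case 7
    then show ?thesis using adj[of a m b c] swap2[of a b c a] assms by simp
  next
    case 8
    then show ?thesis using adj[of b m a d] swap1[of a b b d] assms by simp
  next
    case 9
    then show ?thesis using sum_ord_sign_disjoint[of a m b c d] assms by simp
  qed auto
qed

section \<open>The inner product of a run with the full-design mean\<close>

lemma sum_row_ord_sign:
  assumes "x \<in> runs m" "a < m"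
  shows "(\<Sum>b<m. ord_sign x a b) = real m - 1 - 2 * real (pos x a)"
proof -
  have *: "(\<Sum>i<m. sgn (real i - real k)) = real m - 1 - 2 * real k" if "k < m" for k m
  proof -
    \<comment> \<open>The branch \<open>m \<le> k\<close>, where every sign is -1, lets the
      induction on \<open>m\<close> start at 0.\<close>
    have "(\<Sum>i<m. sgn (real i - real k)) = (if m \<le> k then - real m else real m - 1 - 2 * real k)"
      by (induction m) (auto simp: sgn_if)
    then show ?thesis using that by simp
  qed
  have "(\<Sum>b<m. ord_sign x a b) = (\<Sum>i<m. sgn (real i - real (pos x a)))"
    unfolding ord_sign_def
    by (rule sum.reindex_bij_betw[OF bij_betw_pos[OF assms(1)]])
  moreover have "pos x a < m"
    using bij_betw_pos[OF assms(1)] assms(2) by (auto simp: bij_betw_def)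
  ultimately show ?thesis by (simp add: *)
qed

text \<open>A row sum depends only on the position of its component, and the positions exhaust
  \<open>{..<m}\<close> in every run. This is why the centering constant is the same for all
  runs.\<close>

lemma sum_row_ord_sign_squares:
  assumes "x \<in> runs m"
  shows "(\<Sum>a<m. (\<Sum>b<m. ord_sign x a b)\<^sup>2) = real m * ((real m)\<^sup>2 - 1) / 3"
proof -
  have "(\<Sum>a<m. (\<Sum>b<m. ord_sign x a b)\<^sup>2) = (\<Sum>a<m. (real m - 1 - 2 * real (pos x a))\<^sup>2)"
    using assms by (simp add: sum_row_ord_sign)
  also have "\<dots> = (\<Sum>i<m. (real m - 1 - 2 * real i)\<^sup>2)"
    by (rule sum.reindex_bij_betw[OF bij_betw_pos[OF assms]])
  also have "\<dots> = real m * ((real m)\<^sup>2 - 1) / 3"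
  proof -
    \<comment> \<open>The offset \<open>t\<close> is kept apart from the bound \<open>k\<close> so
      that induction on \<open>k\<close> applies.\<close>
    have "(\<Sum>i<k. (t - 2 * real i)\<^sup>2)
        = real k * t\<^sup>2 - 2 * t * real k * (real k - 1)
          + 2 * real k * (real k - 1) * (2 * real k - 1) / 3" for k t
      by (induction k) (simp_all add: power2_eq_square field_simps)
    from this[of "real m - 1" m] show ?thesis by (simp add: power2_eq_square field_simps)
  qed
  finally show ?thesis .
qed

text \<open>Contracting with the indicator form of the mean leaves only squared row sums and squared
  signs: the value is 2/3 of \<open>2 * (m * (m^2 - 1) / 3) + m * (m - 1)\<close>.\<close>

lemma sum_ord_sign_mean:
  assumes x: "x \<in> runs m"
  shows "(\<Sum>a<m. \<Sum>b<m. \<Sum>c<m. \<Sum>d<m. ord_sign x a b * ord_sign x c d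
      * ((\<Sum>y\<in>runs m. ord_sign y a b * ord_sign y c d) / fact m))
    = real m * (real m - 1) * (4 * real m + 10) / 9"
proof -
  define s where "s = ord_sign x"
  define r where "r = (\<lambda>a. \<Sum>b<m. s a b)"
  have swap: "s b a = - s a b" for a b unfolding s_def by (rule ord_sign_swap)
  have col: "(\<Sum>a<m. s a b) = - r b" for b
    by (simp add: r_def swap[of _ b] sum_negf)
  \<comment> \<open>By antisymmetry the six indicators contribute \<open>r a\<close> twice,
    \<open>- r b\<close> twice and \<open>s a b\<close> twice.\<close>
  have inner: "(\<Sum>c<m. \<Sum>d<m. s a b * s c d
      * ((\<Sum>y\<in>runs m. ord_sign y a b * ord_sign y c d) / fact m))
      = s a b * (2 * (r a - r b + s a b)) / 3" if "a < m" "b < m" for a b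
  proof -
    have "(\<Sum>c<m. \<Sum>d<m. s a b * s c d
        * ((\<Sum>y\<in>runs m. ord_sign y a b * ord_sign y c d) / fact m))
      = (\<Sum>c<m. \<Sum>d<m. s a b / 3 *
         ((if a = c then s c d else 0) + (if b = d then s c d else 0)
          - (if a = d then s c d else 0) - (if b = c then s c d else 0)
          + (if a = c then (if b = d then s c d else 0) else 0)
          - (if b = c then (if a = d then s c d else 0) else 0)))"
      using that by (intro sum.cong refl) (auto simp: mean_ord_sign_product)
    also have "\<dots> = s a b / 3 * (\<Sum>c<m. \<Sum>d<m.
          (if a = c then s c d else 0) + (if b = d then s c d else 0)
          - (if a = d then s c d else 0) - (if b = c then s c d else 0)
          + (if a = c then (if b = d then s c d else 0) else 0)
          - (if b = c then (if a = d then s c d else 0) else 0))"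
      by (simp add: sum_distrib_left)
    also have "(\<Sum>c<m. \<Sum>d<m.
          (if a = c then s c d else 0) + (if b = d then s c d else 0)
          - (if a = d then s c d else 0) - (if b = c then s c d else 0)
          + (if a = c then (if b = d then s c d else 0) else 0)
          - (if b = c then (if a = d then s c d else 0) else 0))
       = 2 * (r a - r b + s a b)"
    proof -
      have if_sum: "(\<Sum>d<m. if P then f d else 0) = (if P then \<Sum>d<m. f d else (0::real))" for P f
        by simp
      show ?thesis
        using that swap[of b a]
        by (simp add: sum.distrib sum_subtractf if_sum col) (simp add: r_def)
    qed
    finally show ?thesis by simp
  qed
  have "(\<Sum>a<m. \<Sum>b<m. \<Sum>c<m. \<Sum>d<m. s a b * s c d
      * ((\<Sum>y\<in>runs m. ord_sign y a b * ord_sign y c d) / fact m))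
    = (\<Sum>a<m. \<Sum>b<m. s a b * (2 * (r a - r b + s a b)) / 3)"
    by (intro sum.cong refl inner) simp_all
  also have "\<dots> = 2 / 3 * ((\<Sum>a<m. \<Sum>b<m. s a b * r a) - (\<Sum>a<m. \<Sum>b<m. s a b * r b)
      + (\<Sum>a<m. \<Sum>b<m. s a b * s a b))"
    by (simp add: sum_distrib_left sum.distrib sum_subtractf algebra_simps
        add_divide_distrib diff_divide_distrib)
  also have "(\<Sum>a<m. \<Sum>b<m. s a b * r a) = (\<Sum>a<m. (r a)\<^sup>2)"
    by (simp add: power2_eq_square r_def flip: sum_distrib_right)
  \<comment> \<open>Column sums are negated row sums, so the difference of the two mixed terms
    doubles instead of cancelling.\<close>
  also have "(\<Sum>a<m. \<Sum>b<m. s a b * r b) = - (\<Sum>a<m. (r a)\<^sup>2)"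
    by (subst sum.swap) (simp add: power2_eq_square col sum_negf flip: sum_distrib_right)
  also have "(\<Sum>a<m. (r a)\<^sup>2) = real m * ((real m)\<^sup>2 - 1) / 3"
    unfolding r_def s_def by (rule sum_row_ord_sign_squares[OF x])
  also have "(\<Sum>a<m. \<Sum>b<m. s a b * s a b) = real m * (real m - 1)"
  proof -
    have "(\<Sum>a<m. \<Sum>b<m. s a b * s a b) = 2 * (\<Sum>(a, b)\<in>comp_pairs m. s a b * s a b)"
    proof (rule sum_comp_pairs)
      show "s a b * s a b = s b a * s b a" for a b using swap[of a b] by simp
      show "s a a * s a a = 0" for a by (simp add: s_def)
    qed
    also have "(\<Sum>(a, b)\<in>comp_pairs m. s a b * s a b) = (\<Sum>p\<in>comp_pairs m. 1)"
      by (rule sum.cong) (auto simp: s_def ord_sign_sq[OF x] comp_pairs_def)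
    finally show ?thesis by (simp add: card_comp_pairs)
  qed
  finally show ?thesis
    unfolding s_def by (simp add: power2_eq_square field_simps)
qed

lemma sum_pwo_mean:
  assumes "x \<in> runs m"
  shows "(\<Sum>p\<in>comp_pairs m. pwo p x * ((\<Sum>y\<in>runs m. pwo p y) / real (card (runs m)))) = 0"
proof (rule sum.neutral, rule ballI)
  fix p assume p: "p \<in> comp_pairs m"
  obtain a b where ab: "p = (a, b)" by (cases p)
  with p have "(\<Sum>y\<in>runs m. pwo p y) = (\<Sum>y\<in>runs m. ord_sign y a b)"
    by (simp add: pwo_eq_ord_sign)
  also have "\<dots> = 0" using p ab by (intro sum_ord_sign) (auto simp: comp_pairs_def)
  finally show "pwo p x * ((\<Sum>y\<in>runs m. pwo p y) / real (card (runs m))) = 0" by simp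
qed

text \<open>Restricting both index pairs to increasing order divides the sum over all quadruples by
  4, which turns the denominator 9 into 36.\<close>

lemma sum_pwo_product_mean:
  assumes x: "x \<in> runs m"
  shows "(\<Sum>(p, r)\<in>comp_pairs m \<times> comp_pairs m. pwo p x * pwo r x
      * ((\<Sum>y\<in>runs m. pwo p y * pwo r y) / real (card (runs m))))
    = real m * (real m - 1) * (4 * real m + 10) / 36"
proof -
  define h where "h = (\<lambda>a b c d. ord_sign x a b * ord_sign x c d
      * ((\<Sum>y\<in>runs m. ord_sign y a b * ord_sign y c d) / fact m))"
  \<comment> \<open>The sign change occurs twice, in the factor of \<open>x\<close> and in the
    mean.\<close>
  have h1: "h b a c d = h a b c d" for a b c d
    by (simp add: h_def ord_sign_swap[of _ b a] sum_negf)
  have h2: "h a b d c = h a b c d" for a b c d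
    by (simp add: h_def ord_sign_swap[of _ d c] sum_negf)
  have h_pwo: "h a b c d = pwo (a, b) x * pwo (c, d) x
      * ((\<Sum>y\<in>runs m. pwo (a, b) y * pwo (c, d) y) / real (card (runs m)))"
    if "(a, b) \<in> comp_pairs m" "(c, d) \<in> comp_pairs m" for a b c d
    using that by (simp add: h_def pwo_eq_ord_sign pwo_eq_ord_sign[OF x] card_runs)
  have "(\<Sum>a<m. \<Sum>b<m. \<Sum>c<m. \<Sum>d<m. h a b c d)
      = 2 * (\<Sum>(a, b)\<in>comp_pairs m. \<Sum>c<m. \<Sum>d<m. h a b c d)"
    by (rule sum_comp_pairs) (auto simp: h1 intro!: sum.cong, simp add: h_def)
  also have "(\<Sum>(a, b)\<in>comp_pairs m. \<Sum>c<m. \<Sum>d<m. h a b c d)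
      = (\<Sum>(a, b)\<in>comp_pairs m. 2 * (\<Sum>(c, d)\<in>comp_pairs m. h a b c d))"
    by (intro sum.cong refl, clarify, rule sum_comp_pairs) (simp_all add: h2, simp add: h_def)
  also have "\<dots> = 2 * (\<Sum>(p, r)\<in>comp_pairs m \<times> comp_pairs m. pwo p x * pwo r x
      * ((\<Sum>y\<in>runs m. pwo p y * pwo r y) / real (card (runs m))))"
    unfolding sum_distrib_left sum.cartesian_product[symmetric]
    by (intro sum.cong refl) (auto simp: h_pwo sum_distrib_left intro!: sum.cong)
  finally show ?thesis
    using sum_ord_sign_mean[OF x] by (simp add: h_def)
qed

section \<open>Kendall tau distance as an inner product of codings\<close>

lemma kendall_tau_commute: "kendall_tau m x y = kendall_tau m y x"
  by (simp add: kendall_tau_def mult.commute)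

lemma kendall_tau_same [simp]: "kendall_tau m x x = 0"
  by (simp add: kendall_tau_def mult_less_0_iff)

text \<open>A product of codings is -1 on discordant pairs and 1 on all others.\<close>

lemma sum_pwo_kendall_tau:
  assumes "x \<in> runs m" "y \<in> runs m"
  shows "(\<Sum>p\<in>comp_pairs m. pwo p x * pwo p y)
    = real (card (comp_pairs m)) - 2 * real (kendall_tau m x y)"
proof -
  define inv where "inv = {(a, b). (a, b) \<in> comp_pairs m \<and>
     (int (pos x a) - int (pos x b)) * (int (pos y a) - int (pos y b)) < 0}"
  have "pwo p x * pwo p y = 1 - 2 * of_bool (p \<in> inv)" if "p \<in> comp_pairs m" for p
  proof -
    obtain a b where ab: "p = (a, b)" by (cases p)
    with that have "a < m" "b < m" "a \<noteq> b" by (auto simp: comp_pairs_def)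
    then show ?thesis
      using that pos_eq_iff[OF assms(1), of a b] pos_eq_iff[OF assms(2), of a b]
      by (auto simp: ab pwo_def inv_def mult_less_0_iff)
  qed
  then have "(\<Sum>p\<in>comp_pairs m. pwo p x * pwo p y)
      = (\<Sum>p\<in>comp_pairs m. 1 - 2 * of_bool (p \<in> inv))"
    by simp
  also have "\<dots> = real (card (comp_pairs m)) - 2 * real (card (comp_pairs m \<inter> inv))"
    by (simp add: sum_subtractf Int_def flip: sum_distrib_left)
  also have "comp_pairs m \<inter> inv = inv" by (auto simp: inv_def)
  finally show ?thesis by (simp add: kendall_tau_def inv_def)
qed

section \<open>The pattern entries as double sums over runs\<close>

lemma J_char_mset: "J_char W (mset D) = (\<Sum>i<length D. pwo_prod W (D ! i))"
  by (simp add: J_char_def sum_mset_sum_list sum_list_sum_nth atLeast0LessThan flip: mset_map)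

lemma J_char_full: "J_char W (full_design m) = (\<Sum>x\<in>runs m. pwo_prod W x)"
  by (simp add: J_char_def full_design_def sum_unfold_sum_mset)

lemma cgwlp_1:
  assumes "D \<noteq> []" "set D \<subseteq> runs m"
  shows "cgwlp m 1 D = (\<Sum>i<length D. \<Sum>j<length D. real (card (comp_pairs m))
    - 2 * real (kendall_tau m (D ! i) (D ! j))) / (real (length D))\<^sup>2"
proof -
  have D: "D ! i \<in> runs m" if "i < length D" for i using that assms(2) nth_mem by blast
  have "{W. W \<subseteq> comp_pairs m \<and> card W = 1} = (\<lambda>p. {p}) ` comp_pairs m"
    by (auto simp: card_1_singleton_iff)
  then have "cgwlp m 1 D = (\<Sum>p\<in>comp_pairs m.
      ((\<Sum>i<length D. pwo p (D ! i)) / real (length D)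
       - (\<Sum>y\<in>runs m. pwo p y) / real (card (runs m)))\<^sup>2)"
    by (simp add: cgwlp_def sum.reindex J_char_mset J_char_full pwo_prod_def card_runs)
  also have "\<dots> = (\<Sum>i<length D. \<Sum>j<length D. \<Sum>p\<in>comp_pairs m. pwo p (D ! i) * pwo p (D ! j))
      / (real (length D))\<^sup>2 - 0"
    by (rule sum_centered_squares[where v = "\<lambda>x p. pwo p x"])
      (use assms D sum_pwo_mean in \<open>auto simp: runs_def\<close>)
  finally show ?thesis by (simp add: sum_pwo_kendall_tau D)
qed

lemma cgwlp_2:
  assumes "D \<noteq> []" "set D \<subseteq> runs m"
  shows "2 * cgwlp m 2 D = (\<Sum>i<length D. \<Sum>j<length D. (real (card (comp_pairs m))
    - 2 * real (kendall_tau m (D ! i) (D ! j)))\<^sup>2) / (real (length D))\<^sup>2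
    - real m * (real m - 1) * (4 * real m + 10) / 36"
proof -
  have D: "D ! i \<in> runs m" if "i < length D" for i using that assms(2) nth_mem by blast
  let ?Q = "comp_pairs m"
  let ?v = "\<lambda>x (p, r). pwo p x * pwo r x"
  let ?c = "\<lambda>k. ((\<Sum>i<length D. ?v (D ! i) k) / real (length D)
       - (\<Sum>y\<in>runs m. ?v y k) / real (card (runs m)))\<^sup>2"
  have "2 * cgwlp m 2 D = (\<Sum>p\<in>?Q. \<Sum>r\<in>?Q. if p = r then 0 else
      (J_char {p, r} (mset D) / real (length D) - J_char {p, r} (full_design m) / fact m)\<^sup>2)"
    unfolding cgwlp_def by (rule sum_two_element_subsets[symmetric]) simp
  \<comment> \<open>On the diagonal both means are 1, as \<open>D\<close> is nonempty, so
    \<open>?c (p, p)\<close> vanishes.\<close>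
  also have "\<dots> = (\<Sum>p\<in>?Q. \<Sum>r\<in>?Q. ?c (p, r))"
    using assms(1)
    by (intro sum.cong refl) (simp add: J_char_mset J_char_full pwo_prod_def card_runs)
  also have "\<dots> = (\<Sum>k\<in>?Q \<times> ?Q. ?c k)"
    by (simp add: sum.cartesian_product case_prod_unfold)
  also have "\<dots> = (\<Sum>i<length D. \<Sum>j<length D. \<Sum>k\<in>?Q \<times> ?Q. ?v (D ! i) k * ?v (D ! j) k)
      / (real (length D))\<^sup>2 - real m * (real m - 1) * (4 * real m + 10) / 36"
  proof (rule sum_centered_squares)
    fix x assume "x \<in> runs m"
    from sum_pwo_product_mean[OF this]
    show "(\<Sum>k\<in>?Q \<times> ?Q. ?v x k * ((\<Sum>y\<in>runs m. ?v y k) / real (card (runs m))))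
        = real m * (real m - 1) * (4 * real m + 10) / 36"
      by (simp add: case_prod_unfold)
  qed (use assms D in \<open>auto simp: runs_def\<close>)
  \<comment> \<open>Vectors of pairwise products are tensor squares, so their inner product is the
    square of the original one.\<close>
  also have "(\<Sum>i<length D. \<Sum>j<length D. \<Sum>k\<in>?Q \<times> ?Q. ?v (D ! i) k * ?v (D ! j) k)
      = (\<Sum>i<length D. \<Sum>j<length D. (\<Sum>p\<in>?Q. pwo p (D ! i) * pwo p (D ! j))\<^sup>2)"
    by (simp add: power2_eq_square sum_product sum.cartesian_product case_prod_unfold mult_ac)
  also have "\<dots> = (\<Sum>i<length D. \<Sum>j<length D. (real (card (comp_pairs m))
      - 2 * real (kendall_tau m (D ! i) (D ! j)))\<^sup>2)"
    by (simp add: sum_pwo_kendall_tau D)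
  finally show ?thesis .
qed

lemma sum_kendall_tau:
  assumes "length D \<ge> 2"
  shows "(\<Sum>i<length D. \<Sum>j<length D. real (kendall_tau m (D ! i) (D ! j)))
      = real (length D) * (real (length D) - 1) * k_ave m D"
    and "(\<Sum>i<length D. \<Sum>j<length D. (real (kendall_tau m (D ! i) (D ! j)))\<^sup>2)
      = real (length D) * (real (length D) - 1) * k_m2 m D"
proof -
  \<comment> \<open>Two runs make the binomial divisor in \<open>k_ave\<close> and
    \<open>k_m2\<close> nonzero, so it can be cleared.\<close>
  have nz: "real (length D) * (real (length D) - 1) \<noteq> 0" using assms by auto
  have "(\<Sum>i<length D. \<Sum>j<length D. real (kendall_tau m (D ! i) (D ! j)))
      = 2 * (\<Sum>(i, j)\<in>comp_pairs (length D). real (kendall_tau m (D ! i) (D ! j)))"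
    by (rule sum_comp_pairs) (simp_all add: kendall_tau_commute[of m])
  then show "(\<Sum>i<length D. \<Sum>j<length D. real (kendall_tau m (D ! i) (D ! j)))
      = real (length D) * (real (length D) - 1) * k_ave m D"
    using nz by (simp add: k_ave_def comp_pairs_def choose_two_real)
  have "(\<Sum>i<length D. \<Sum>j<length D. (real (kendall_tau m (D ! i) (D ! j)))\<^sup>2)
      = 2 * (\<Sum>(i, j)\<in>comp_pairs (length D). (real (kendall_tau m (D ! i) (D ! j)))\<^sup>2)"
    by (rule sum_comp_pairs) (simp_all add: kendall_tau_commute[of m])
  then show "(\<Sum>i<length D. \<Sum>j<length D. (real (kendall_tau m (D ! i) (D ! j)))\<^sup>2)
      = real (length D) * (real (length D) - 1) * k_m2 m D"
    using nz by (simp add: k_m2_def comp_pairs_def choose_two_real)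
qed

theorem proposition1:
  fixes m n q :: nat and D :: "nat list list"
  assumes "m \<ge> 1" and "n \<ge> 2"
    and "q = m choose 2"
    and "oofa_design m n D"
  shows "cgwlp m 1 D = real q - 2 * (real n - 1) / real n * k_ave m D
    \<and> cgwlp m 2 D =
        real q * (real q - 1) / 2
        - 2 * real q * (real n - 1) / real n * k_ave m D
        + 2 * (real n - 1) / real n * k_m2 m D
        - real m * (real m - 1) * (real m - 2) / 18"
proof -
  have n: "length D = n" and D: "set D \<subseteq> runs m" "D \<noteq> []"
    using assms by (auto simp: oofa_design_def)
  have q: "real (card (comp_pairs m)) = real q"
    by (simp add: card_comp_pairs assms(3) choose_two_real)
  have n0: "real n > 0" using assms(2) by simp
  define K where "K = (\<lambda>i j. real (kendall_tau m (D ! i) (D ! j)))"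
  then have K: "real (kendall_tau m (D ! i) (D ! j)) = K i j" for i j by simp
  have K1: "(\<Sum>i<n. \<Sum>j<n. K i j) = real n * (real n - 1) * k_ave m D"
    and K2: "(\<Sum>i<n. \<Sum>j<n. (K i j)\<^sup>2) = real n * (real n - 1) * k_m2 m D"
    using sum_kendall_tau[of D m] assms(2) n by (simp_all add: K_def)
  have "(\<Sum>i<n. \<Sum>j<n. real q - 2 * K i j) = (real n)\<^sup>2 * real q - 2 * (\<Sum>i<n. \<Sum>j<n. K i j)"
    by (simp add: sum_subtractf power2_eq_square flip: sum_distrib_left)
  then have "cgwlp m 1 D = ((real n)\<^sup>2 * real q - 2 * (real n * (real n - 1) * k_ave m D)) / (real n)\<^sup>2"
    using cgwlp_1[OF D(2,1)] unfolding n q K K1 by simp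
  also have "\<dots> = real q - 2 * (real n - 1) / real n * k_ave m D"
    using n0 by (simp add: power2_eq_square field_simps)
  finally have C1: "cgwlp m 1 D = real q - 2 * (real n - 1) / real n * k_ave m D" .
  have "(\<Sum>i<n. \<Sum>j<n. (real q - 2 * K i j)\<^sup>2)
      = (\<Sum>i<n. \<Sum>j<n. (real q)\<^sup>2 - 4 * real q * K i j + 4 * (K i j)\<^sup>2)"
    by (simp add: power2_eq_square algebra_simps)
  also have "\<dots> = (real n)\<^sup>2 * (real q)\<^sup>2 - 4 * real q * (\<Sum>i<n. \<Sum>j<n. K i j)
      + 4 * (\<Sum>i<n. \<Sum>j<n. (K i j)\<^sup>2)"
    by (simp add: sum.distrib sum_subtractf power2_eq_square flip: sum_distrib_left)
  finally have "2 * cgwlp m 2 D = ((real n)\<^sup>2 * (real q)\<^sup>2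
      - 4 * real q * (real n * (real n - 1) * k_ave m D)
      + 4 * (real n * (real n - 1) * k_m2 m D)) / (real n)\<^sup>2
      - real m * (real m - 1) * (4 * real m + 10) / 36"
    using cgwlp_2[OF D(2,1)] unfolding n q K K1 K2 by simp
  also have "\<dots> = (real q)\<^sup>2 - 4 * real q * (real n - 1) / real n * k_ave m D
      + 4 * (real n - 1) / real n * k_m2 m D
      - real m * (real m - 1) * (4 * real m + 10) / 36"
    using n0 by (simp add: power2_eq_square field_simps)
  \<comment> \<open>The part \<open>real q\<close> is the diagonal contribution of the constant, 1
    for each pair; it turns \<open>q^2\<close> into \<open>q * (q - 1)\<close>. The rest, halved, is
    the final term of the claim.\<close>
  also have "real m * (real m - 1) * (4 * real m + 10) / 36
      = real q + real m * (real m - 1) * (real m - 2) / 9"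
    by (simp add: assms(3) choose_two_real field_simps)
  finally show ?thesis
    using C1 n0
    by (simp add: power2_eq_square algebra_simps add_divide_distrib diff_divide_distrib)
qed

end
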